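(* If $R$ is a quasiorder on a non-empty set $U$, then $\mathcal{RS}$ is a completely distributive complete lattice such that $$\bigwedge_{i\in I}\mathcal{A}(X_i)=\Big(\bigcap_{i\in I}X_i^{\blacktriangledown},\bigcap_{i\in I}X_i^{\blacktriangle}\Big)\quad\text{and}\quad\bigvee_{i\in I}\mathcal{A}(X_i)=\Big(\bigcup_{i\in I}X_i^{\blacktriangledown},\bigcup_{i\in I}X_i^{\blacktriangle}\Big)$$ for all $\{\mathcal{A}(X_i)\mid i\in I\}\subseteq RS$.
   Context: A quasiorder is a reflexive and transitive binary relation. For a binary relation $R$ on a set $U$ and $x\in U$, $R(x)=\{y\in U\mid x\,R\,y\}$. For $X\subseteq U$, $X^{\blacktriangledown}=\{x\in U\mid R(x)\subseteq X\}$ is the lower approximation and $X^{\blacktriangle}=\{x\in U\mid R(x)\cap X\neq\emptyset\}$ is the upper approximation of $X$. The rough set of $X$ is the pair $\mathcal{A}(X)=(X^{\blacktriangledown},X^{\blacktriangle})$, and $RS=\{\mathcal{A}(X)\mid X\subseteq U\}$. $\mathcal{RS}=(RS,\leq)$ where $\leq$ is the coordinatewise inclusion order: $(X^{\blacktriangledown},X^{\blacktriangle})\leq(Y^{\blacktriangledown},Y^{\blacktriangle})$ iff $X^{\blacktriangledown}\subseteq Y^{\blacktriangledown}$ and $X^{\blacktriangle}\subseteq Y^{\blacktriangle}$. Unions and intersections are taken in $\wp(U)$ (so the empty intersection is $U$). *)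

theory Defs
  imports "HOL-Algebra.Complete_Lattice"
begin

(* The relativisation to the carrier of the axiom Inf_Sup of the type class
   complete_distrib_lattice.  As A ranges over all sets of subsets of the carrier, no index
   types occur; the law for doubly indexed families over arbitrary index types is derived
   in Inf_Sup_indexed below. *)
locale completely_distributive_lattice = complete_lattice +
  assumes Inf_Sup:
    "(\<And>Y. Y \<in> A \<Longrightarrow> Y \<subseteq> carrier L) \<Longrightarrow>
      \<Sqinter>((\<lambda>Y. \<Squnion>Y) ` A) = \<Squnion>((\<lambda>Z. \<Sqinter>Z) ` {f ` A | f. \<forall>Y\<in>A. f Y \<in> Y})"

lemma (in completely_distributive_lattice) Inf_Sup_indexed:
  fixes I :: "'i set" and J :: "'i \<Rightarrow> 'j set"
  assumes x: "\<And>i j. i \<in> I \<Longrightarrow> j \<in> J i \<Longrightarrow> x i j \<in> carrier L"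
  shows "\<Sqinter>((\<lambda>i. \<Squnion>((\<lambda>j. x i j) ` J i)) ` I) =
    \<Squnion>((\<lambda>g. \<Sqinter>((\<lambda>i. x i (g i)) ` I)) ` (Pi I J))"
proof -
  define A where "A = (\<lambda>i. x i ` J i) ` I"
  have A: "Y \<subseteq> carrier L" if "Y \<in> A" for Y
    using that x by (auto simp: A_def)
  have "{f ` A | f. \<forall>Y\<in>A. f Y \<in> Y} \<subseteq> (\<lambda>g. (\<lambda>i. x i (g i)) ` I) ` Pi I J"
  proof safe
    fix f assume f: "\<forall>Y\<in>A. f Y \<in> Y"
    have "\<forall>i\<in>I. \<exists>j\<in>J i. f (x i ` J i) = x i j"
      using f by (auto simp: A_def)
    then obtain g where g: "\<And>i. i \<in> I \<Longrightarrow> g i \<in> J i \<and> f (x i ` J i) = x i (g i)"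
      by metis
    have "f ` A = (\<lambda>i. x i (g i)) ` I"
      unfolding A_def image_image using g by (intro image_cong) auto
    with g show "f ` A \<in> (\<lambda>g. (\<lambda>i. x i (g i)) ` I) ` Pi I J"
      by (intro image_eqI[of _ _ g]) auto
  qed
  then have sub: "(\<lambda>Z. \<Sqinter>Z) ` {f ` A | f. \<forall>Y\<in>A. f Y \<in> Y} \<subseteq>
      (\<lambda>g. \<Sqinter>((\<lambda>i. x i (g i)) ` I)) ` Pi I J" (is "?P \<subseteq> ?Q")
    by (auto dest!: subsetD)
  have xg: "(\<lambda>i. x i (g i)) ` I \<subseteq> carrier L" if "g \<in> Pi I J" for g
    using that x by auto
  have Q: "?Q \<subseteq> carrier L"
    using xg by (auto intro!: weak.inf_closed)
  have xJ: "x i ` J i \<subseteq> carrier L" if "i \<in> I" for i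
    using that x by auto
  have S: "(\<lambda>i. \<Squnion>(x i ` J i)) ` I \<subseteq> carrier L"
    using xJ by (auto intro!: weak.sup_closed)
  have eq: "\<Sqinter>((\<lambda>i. \<Squnion>(x i ` J i)) ` I) = \<Squnion>?P"
    using Inf_Sup[of A] A by (simp add: A_def image_image)
  have "\<Squnion>?P \<sqsubseteq> \<Squnion>?Q"
    using sub Q by (intro weak.sup_least weak.sup_upper weak.sup_closed) auto
  moreover have "\<Squnion>?Q \<sqsubseteq> \<Sqinter>((\<lambda>i. \<Squnion>(x i ` J i)) ` I)"
  proof (rule weak.sup_least[OF Q weak.inf_closed[OF S]])
    fix q assume "q \<in> ?Q"
    then obtain g where g: "g \<in> Pi I J" and q: "q = \<Sqinter>((\<lambda>i. x i (g i)) ` I)" by blast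
    have qc: "q \<in> carrier L" unfolding q using xg[OF g] by (rule weak.inf_closed)
    show "q \<sqsubseteq> \<Sqinter>((\<lambda>i. \<Squnion>(x i ` J i)) ` I)"
    proof (rule weak.inf_greatest[OF S qc])
      fix s assume "s \<in> (\<lambda>i. \<Squnion>(x i ` J i)) ` I"
      then obtain i where i: "i \<in> I" and s: "s = \<Squnion>(x i ` J i)" by blast
      have "q \<sqsubseteq> x i (g i)"
        unfolding q using xg[OF g] i by (intro weak.inf_lower) auto
      moreover have "x i (g i) \<sqsubseteq> s"
        unfolding s using xJ[OF i] g i by (intro weak.sup_upper) auto
      ultimately show "q \<sqsubseteq> s"
        using qc x[of i "g i"] g i xJ[OF i] s by (meson PiE le_trans weak.sup_closed)
    qed
  qed
  ultimately show ?thesis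
    unfolding eq using weak.sup_closed[OF order.trans[OF sub Q]] weak.sup_closed[OF Q]
    by (intro le_antisym) simp_all
qed

definition lower_approx :: "'a set \<Rightarrow> 'a rel \<Rightarrow> 'a set \<Rightarrow> 'a set" where
  "lower_approx U R X = {x \<in> U. R `` {x} \<subseteq> X}"

definition upper_approx :: "'a set \<Rightarrow> 'a rel \<Rightarrow> 'a set \<Rightarrow> 'a set" where
  "upper_approx U R X = {x \<in> U. R `` {x} \<inter> X \<noteq> {}}"

definition rough_set :: "'a set \<Rightarrow> 'a rel \<Rightarrow> 'a set \<Rightarrow> 'a set \<times> 'a set" where
  "rough_set U R X = (lower_approx U R X, upper_approx U R X)"

definition RS :: "'a set \<Rightarrow> 'a rel \<Rightarrow> ('a set \<times> 'a set) gorder" where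
  "RS U R = \<lparr>carrier = {rough_set U R X | X. X \<subseteq> U}, eq = (=),
     le = (\<lambda>p q. fst p \<subseteq> fst q \<and> snd p \<subseteq> snd q)\<rparr>"

end

theory Submission
  imports Defs
begin

text \<open>
  A pair \<open>(A, B)\<close> of subsets of \<open>U\<close> is a rough set exactly when \<open>A \<subseteq> B\<close>, \<open>A\<close> is closed under
  \<open>R\<close>-successors, \<open>B\<close> is closed under \<open>R\<close>-predecessors, and every point of \<open>B\<close> whose only
  successor is itself lies in \<open>A\<close> (lemma \<open>mem_carrier_RS_iff\<close>). Each of these four conditions
  survives arbitrary unions and intersections taken coordinatewise. Hence \<open>RS\<close> contains the
  coordinatewise meets and joins, \<open>(U, U)\<close> and \<open>({}, {})\<close> being the empty ones, so that it is a
  complete sublattice of \<open>\<wp>(U) \<times> \<wp>(U)\<close> and inherits complete distributivity from it.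

  The substance is that the four conditions suffice. Given \<open>(A, B)\<close>, the set \<open>X\<close> sought has the
  form \<open>A \<union> Y\<close> with \<open>Y \<subseteq> B - A\<close>, and for every \<open>x \<in> B - A\<close> the set \<open>R(x)\<close> has to meet \<open>X\<close>
  without being contained in it. If \<open>R(x)\<close> meets \<open>A\<close>, or is not contained in \<open>B\<close>, one of these
  two requirements is automatic and the other is met by deciding whether \<open>x\<close> itself is in \<open>Y\<close>.
  The remaining points \<open>x\<close> satisfy \<open>R(x) \<subseteq> B - A\<close>. They form a set \<open>E\<close> closed under
  successors in which every point has a successor other than itself, and it suffices to split
  \<open>E\<close> into two parts each of which meets every \<open>R(x)\<close>. Such a splitting exists by Zorn's lemma
  (lemma \<open>ex_cofinal_split\<close>).
\<close>

section \<open>Splitting a set into two cofinal parts\<close>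

text \<open>
  The two colours of a splitting are the parities of the indices of such a sequence. If \<open>x\<close> sees
  two distinct points related to each other both ways, alternating between them works. If not,
  a sequence that moves to a different successor at every step never repeats a value, since
  a return would put a point and its next one into such a mutual relation.
\<close>

lemma ex_alternating_sequence:
  assumes "trans R" and x: "x \<in> D"
    and step: "\<And>x. x \<in> D \<Longrightarrow> \<exists>y\<in>D. y \<noteq> x \<and> (x, y) \<in> R"
  obtains s :: "nat \<Rightarrow> 'a" where "\<And>n. s n \<in> D" "\<And>n. (x, s n) \<in> R"
    "\<And>n. (s n, s (Suc n)) \<in> R" "\<And>m n. s m = s n \<Longrightarrow> even m = even n"
proof (cases "\<exists>y\<in>D. \<exists>z\<in>D. (x, y) \<in> R \<and> y \<noteq> z \<and> (y, z) \<in> R \<and> (z, y) \<in> R")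
  case True
  then obtain y z where "y \<in> D" "z \<in> D" "(x, y) \<in> R" "y \<noteq> z" "(y, z) \<in> R" "(z, y) \<in> R"
    by blast
  with \<open>trans R\<close> show ?thesis
    by (intro that[of "\<lambda>n. if even n then y else z"]) (auto dest: transD split: if_splits)
next
  case False
  obtain f where f: "f y \<in> D" "f y \<noteq> y" "(y, f y) \<in> R" if "y \<in> D" for y
    using step by metis
  define s where "s n = (f ^^ Suc n) x" for n
  have sD: "s n \<in> D" for n
    by (induction n) (simp_all add: s_def f x)
  have s_Suc: "(s n, s (Suc n)) \<in> R" "s (Suc n) \<noteq> s n" for n
    using f[OF sD[of n]] by (simp_all add: s_def)
  have xs: "(x, s n) \<in> R" for n
  proof (induction n)
    case 0
    show ?case using f[OF x] by (simp add: s_def)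
  next
    case (Suc n)
    then show ?case using s_Suc(1)[of n] \<open>trans R\<close> by (blast dest: transD)
  qed
  have le: "s (Suc m) = s n \<or> (s (Suc m), s n) \<in> R" if "m < n" for m n
    using that
  proof (induction n)
    case (Suc n)
    then show ?case
      using s_Suc(1)[of n] \<open>trans R\<close> by (metis less_SucE transD)
  qed simp
  have "s m \<noteq> s n" if "m < n" for m n
    using le[OF that] s_Suc[of m] False sD xs by metis
  then have "s m = s n \<Longrightarrow> m = n" for m n
    by (metis linorder_neqE_nat)
  then show ?thesis
    by (intro that[of s]) (use sD xs s_Suc in blast)+
qed

text \<open>
  Zorn's lemma is applied to partial two-colourings of \<open>D\<close>, given as graphs, in which every
  coloured point sees both colours. In a maximal one every \<open>x \<in> D\<close> sees both colours: if
  \<open>x\<close> sees a coloured point, this holds by transitivity, and otherwise an alternating sequence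
  above \<open>x\<close> is entirely uncoloured and could be added to the colouring.
\<close>

lemma ex_cofinal_split:
  assumes "trans R"
    and step: "\<And>x. x \<in> D \<Longrightarrow> \<exists>y\<in>D. y \<noteq> x \<and> (x, y) \<in> R"
  obtains Z where "Z \<subseteq> D" "\<And>x. x \<in> D \<Longrightarrow> \<exists>z\<in>Z. (x, z) \<in> R"
    "\<And>x. x \<in> D \<Longrightarrow> \<exists>z\<in>D - Z. (x, z) \<in> R"
proof -
  define F where "F = {W. W \<subseteq> D \<times> (UNIV :: bool set) \<and>
    (\<forall>x. (x, True) \<in> W \<longrightarrow> (x, False) \<notin> W) \<and>
    (\<forall>x c b. (x, c) \<in> W \<longrightarrow> (\<exists>y. (y, b) \<in> W \<and> (x, y) \<in> R))}"
  have F_I: "W \<in> F" if "W \<subseteq> D \<times> UNIV" "\<And>x. (x, True) \<in> W \<Longrightarrow> (x, False) \<notin> W"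
    "\<And>x c b. (x, c) \<in> W \<Longrightarrow> \<exists>y. (y, b) \<in> W \<and> (x, y) \<in> R" for W
    unfolding F_def by (intro CollectI conjI allI impI) (fact that)+
  have F_D: "x \<in> D" if "W \<in> F" "(x, c) \<in> W" for W x c
    using that by (auto simp: F_def)
  have F_cons: "(x, False) \<notin> W" if "W \<in> F" "(x, True) \<in> W" for W x
    using that by (simp add: F_def)
  have F_sees: "\<exists>y. (y, b) \<in> W \<and> (x, y) \<in> R" if "W \<in> F" "(x, c) \<in> W" for W x c b
  proof -
    have "\<forall>x c b. (x, c) \<in> W \<longrightarrow> (\<exists>y. (y, b) \<in> W \<and> (x, y) \<in> R)"
      using that(1) unfolding F_def mem_Collect_eq by (elim conjE)
    from this[rule_format, OF that(2)] show ?thesis .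
  qed
  have "\<exists>M\<in>F. \<forall>W\<in>F. M \<subseteq> W \<longrightarrow> W = M"
  proof (rule subset_Zorn')
    fix C assume C: "subset.chain F C"
    then have CF: "C \<subseteq> F" and lin: "\<And>V W. V \<in> C \<Longrightarrow> W \<in> C \<Longrightarrow> V \<subseteq> W \<or> W \<subseteq> V"
      by (auto simp: subset_chain_def)
    show "\<Union>C \<in> F"
    proof (rule F_I)
      show "\<Union>C \<subseteq> D \<times> UNIV"
        using F_D CF by auto
      show "(x, False) \<notin> \<Union>C" if "(x, True) \<in> \<Union>C" for x
      proof
        assume "(x, False) \<in> \<Union>C"
        with that obtain V W where "V \<in> C" "(x, True) \<in> V" "W \<in> C" "(x, False) \<in> W" by blast
        with lin[of V W] CF F_cons[of V x] F_cons[of W x] show False by blast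
      qed
      show "\<exists>y. (y, b) \<in> \<Union>C \<and> (x, y) \<in> R" if xc: "(x, c) \<in> \<Union>C" for x c b
      proof -
        from xc obtain W where "W \<in> C" "(x, c) \<in> W" by blast
        with CF F_sees[of W x c b] show ?thesis by blast
      qed
    qed
  qed
  then obtain W where W: "W \<in> F" and max: "\<And>V. V \<in> F \<Longrightarrow> W \<subseteq> V \<Longrightarrow> V = W"
    by blast
  note WD = F_D[OF W] and Wc = F_cons[OF W] and Wb = F_sees[OF W]
  have sees: "\<exists>y. (y, b) \<in> W \<and> (x, y) \<in> R" if x: "x \<in> D" for x b
  proof (cases "\<exists>y c. (x, y) \<in> R \<and> (y, c) \<in> W")
    case True
    with Wb \<open>trans R\<close> show ?thesis by (meson transD)
  next
    case False
    obtain s :: "nat \<Rightarrow> 'a" where s: "\<And>n. s n \<in> D" "\<And>n. (x, s n) \<in> R"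
      "\<And>n. (s n, s (Suc n)) \<in> R" "\<And>m n. s m = s n \<Longrightarrow> even m = even n"
      using ex_alternating_sequence[OF \<open>trans R\<close> x step] by blast
    \<comment> \<open>The sequence gives both colours to points above each of its members, one and two
      steps further on.\<close>
    define V where "V = W \<union> range (\<lambda>n. (s n, even n))"
    have s2: "(s n, s (Suc (Suc n))) \<in> R" for n
      using s(3) \<open>trans R\<close> by (meson transD)
    have new: "(s n, c) \<notin> W" for n c
      using False s(2) by blast
    have "V \<in> F"
    proof (rule F_I)
      show "V \<subseteq> D \<times> UNIV"
        using WD s(1) by (auto simp: V_def)
      show "(y, False) \<notin> V" if "(y, True) \<in> V" for y
      proof
        assume "(y, False) \<in> V"
        with that Wc[of y] new show False
          by (auto simp: V_def dest: s(4))
      qed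
      show "\<exists>z. (z, b) \<in> V \<and> (y, z) \<in> R" if "(y, c) \<in> V" for y c b
      proof (cases "(y, c) \<in> W")
        case True
        with Wb[of y c b] show ?thesis by (auto simp: V_def)
      next
        case False
        with that obtain n where n: "y = s n" by (auto simp: V_def)
        define m where "m = (if even n = b then Suc (Suc n) else Suc n)"
        have "even m = b" "(y, s m) \<in> R"
          using s(3)[of n] s2[of n] n by (auto simp: m_def)
        then show ?thesis by (auto simp: V_def)
      qed
    qed
    then have "V = W"
      by (rule max) (simp add: V_def)
    moreover have "(s 0, True) \<in> V"
      unfolding V_def by (intro UnI2 image_eqI[of _ _ 0]) simp_all
    ultimately have "(s 0, True) \<in> W" by simp
    with new show ?thesis by blast
  qed
  show ?thesis
  proof (rule that[of "{x. (x, True) \<in> W}"])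
    show "{x. (x, True) \<in> W} \<subseteq> D" using WD by blast
    show "\<exists>z\<in>{x. (x, True) \<in> W}. (x, z) \<in> R" if "x \<in> D" for x
      using sees[OF that, of True] by blast
    show "\<exists>z\<in>D - {x. (x, True) \<in> W}. (x, z) \<in> R" if "x \<in> D" for x
      using sees[OF that, of False] WD Wc by blast
  qed
qed

section \<open>Which pairs are rough sets\<close>

lemma preorder_onD:
  assumes "preorder_on U R"
  shows "R \<subseteq> U \<times> U" "\<And>x. x \<in> U \<Longrightarrow> (x, x) \<in> R" "trans R"
  using assms by (auto simp: preorder_on_def refl_on_def)

text \<open>
  The last condition is what a singleton neighbourhood \<open>R(x) = {x}\<close> forces: it meets \<open>X\<close> only
  if it is contained in \<open>X\<close>. For the converse, \<open>E\<close> collects the points of \<open>B - A\<close> for which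
  neither requirement on \<open>X\<close> is automatic.
\<close>

lemma mem_carrier_RS_iff:
  assumes R: "preorder_on U R"
  shows "(A, B) \<in> carrier (RS U R) \<longleftrightarrow>
    A \<subseteq> B \<and> B \<subseteq> U \<and> (\<forall>x y. (x, y) \<in> R \<longrightarrow> x \<in> A \<longrightarrow> y \<in> A) \<and>
    (\<forall>x y. (x, y) \<in> R \<longrightarrow> y \<in> B \<longrightarrow> x \<in> B) \<and> (\<forall>x\<in>B. R `` {x} = {x} \<longrightarrow> x \<in> A)"
    (is "?L \<longleftrightarrow> ?C")
proof
  note sub = preorder_onD(1)[OF R] and refl = preorder_onD(2)[OF R]
    and tr = transD[OF preorder_onD(3)[OF R]]
  assume ?L
  then obtain X where X: "X \<subseteq> U" "A = lower_approx U R X" "B = upper_approx U R X"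
    by (auto simp: RS_def rough_set_def)
  have "A \<subseteq> B" "B \<subseteq> U"
    using refl by (auto simp: X lower_approx_def upper_approx_def)
  moreover have "y \<in> A" if "(x, y) \<in> R" "x \<in> A" for x y
    using that tr sub by (auto simp: X lower_approx_def)
  moreover have "x \<in> B" if "(x, y) \<in> R" "y \<in> B" for x y
  proof -
    from that obtain z where "(y, z) \<in> R" "z \<in> X" by (auto simp: X upper_approx_def)
    with tr[OF that(1)] that sub show ?thesis by (auto simp: X upper_approx_def)
  qed
  moreover have "x \<in> A" if "x \<in> B" "R `` {x} = {x}" for x
    using that by (auto simp: X lower_approx_def upper_approx_def)
  ultimately show ?C by blast
next
  note sub = preorder_onD(1)[OF R] and refl = preorder_onD(2)[OF R]
    and tr = transD[OF preorder_onD(3)[OF R]]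
  assume ?C
  then have AB: "A \<subseteq> B" and BU: "B \<subseteq> U"
    and up: "\<And>x y. (x, y) \<in> R \<Longrightarrow> x \<in> A \<Longrightarrow> y \<in> A"
    and down: "\<And>x y. (x, y) \<in> R \<Longrightarrow> y \<in> B \<Longrightarrow> x \<in> B"
    and single: "\<And>x. x \<in> B \<Longrightarrow> R `` {x} = {x} \<Longrightarrow> x \<in> A"
    by blast+
  define E where "E = {x \<in> B - A. R `` {x} \<inter> A = {} \<and> R `` {x} \<subseteq> B}"
  have E_up: "y \<in> E" if "x \<in> E" "(x, y) \<in> R" for x y
    using that tr by (auto simp: E_def)
  have E_step: "\<exists>y\<in>E. y \<noteq> x \<and> (x, y) \<in> R" if "x \<in> E" for x
  proof -
    have "R `` {x} \<noteq> {x}" "(x, x) \<in> R"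
      using that single refl BU by (auto simp: E_def)
    then obtain y where "(x, y) \<in> R" "y \<noteq> x" by blast
    with E_up[OF that] show ?thesis by blast
  qed
  obtain Z where ZE: "Z \<subseteq> E" and Z: "\<And>x. x \<in> E \<Longrightarrow> \<exists>z\<in>Z. (x, z) \<in> R"
    and EZ: "\<And>x. x \<in> E \<Longrightarrow> \<exists>z\<in>E - Z. (x, z) \<in> R"
    using ex_cofinal_split[OF preorder_onD(3)[OF R] E_step] by blast
  \<comment> \<open>The points of \<open>N\<close> need a witness for meeting \<open>X\<close> and serve as their own; the points
    of \<open>B - A\<close> whose \<open>R(x)\<close> meets \<open>A\<close> stay out of \<open>X\<close>.\<close>
  define N where "N = {x \<in> B - A. R `` {x} \<inter> A = {} \<and> \<not> R `` {x} \<subseteq> B}"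
  define X where "X = A \<union> N \<union> Z"
  have XB: "X \<subseteq> B"
    using AB ZE by (auto simp: X_def N_def E_def)
  have "x \<in> A" if x: "x \<in> U" "R `` {x} \<subseteq> X" for x
  proof (rule ccontr)
    assume xA: "x \<notin> A"
    have xX: "x \<in> X" "x \<in> B" "R `` {x} \<subseteq> B" using x refl XB by blast+
    then have "x \<in> Z" using xA by (auto simp: X_def N_def)
    then obtain z where z: "z \<in> E" "z \<notin> Z" "(x, z) \<in> R" using EZ ZE by blast
    then have "z \<notin> X" by (auto simp: X_def N_def E_def)
    with z x show False by blast
  qed
  moreover have "x \<in> U \<and> R `` {x} \<subseteq> X" if "x \<in> A" for x
    using that AB BU up by (auto simp: X_def)
  ultimately have A: "A = lower_approx U R X"
    by (auto simp: lower_approx_def)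
  have "R `` {x} \<inter> X \<noteq> {}" if x: "x \<in> B" for x
  proof -
    have xx: "(x, x) \<in> R" using x BU refl by blast
    consider "R `` {x} \<inter> A \<noteq> {}" | "x \<in> N" | "x \<in> E"
      using x xx by (auto simp: N_def E_def)
    then show ?thesis
      using xx Z[of x] by cases (auto simp: X_def)
  qed
  then have B: "B = upper_approx U R X"
    using XB BU down by (auto simp: upper_approx_def)
  have "(A, B) = rough_set U R X" "X \<subseteq> U"
    using A B XB BU unfolding rough_set_def by blast+
  then show ?L
    unfolding RS_def by auto
qed

section \<open>Rough sets form a complete sublattice of pairs of sets\<close>

lemma le_RS [simp]: "le (RS U R) p q \<longleftrightarrow> fst p \<subseteq> fst q \<and> snd p \<subseteq> snd q"
  by (simp add: RS_def)

lemma partial_order_RS: "partial_order (RS U R)"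
  by standard (auto simp: RS_def rough_set_def)

lemma carrier_RS_subset:
  assumes "p \<in> carrier (RS U R)"
  shows "fst p \<subseteq> U" "snd p \<subseteq> U"
  using assms by (auto simp: RS_def rough_set_def lower_approx_def upper_approx_def)

lemma carrier_RS_closed:
  assumes "preorder_on U R" "p \<in> carrier (RS U R)"
  shows "fst p \<subseteq> snd p" "(x, y) \<in> R \<Longrightarrow> x \<in> fst p \<Longrightarrow> y \<in> fst p"
    "(x, y) \<in> R \<Longrightarrow> y \<in> snd p \<Longrightarrow> x \<in> snd p" "x \<in> snd p \<Longrightarrow> R `` {x} = {x} \<Longrightarrow> x \<in> fst p"
  using assms(2) mem_carrier_RS_iff[OF assms(1), of "fst p" "snd p"] by simp_all

lemma Inter_mem_carrier_RS:
  assumes R: "preorder_on U R" and P: "P \<subseteq> carrier (RS U R)"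
  shows "(U \<inter> (\<Inter>p\<in>P. fst p), U \<inter> (\<Inter>p\<in>P. snd p)) \<in> carrier (RS U R)"
  unfolding mem_carrier_RS_iff[OF R]
proof (intro conjI allI impI ballI)
  note C = carrier_RS_closed[OF R subsetD[OF P]]
  show "U \<inter> (\<Inter>p\<in>P. fst p) \<subseteq> U \<inter> (\<Inter>p\<in>P. snd p)"
    using C(1) by blast
  show "y \<in> U \<inter> (\<Inter>p\<in>P. fst p)" if "(x, y) \<in> R" "x \<in> U \<inter> (\<Inter>p\<in>P. fst p)" for x y
    using that C(2)[OF _ that(1)] preorder_onD(1)[OF R] by auto
  show "x \<in> U \<inter> (\<Inter>p\<in>P. snd p)" if "(x, y) \<in> R" "y \<in> U \<inter> (\<Inter>p\<in>P. snd p)" for x y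
    using that C(3)[OF _ that(1)] preorder_onD(1)[OF R] by auto
  show "x \<in> U \<inter> (\<Inter>p\<in>P. fst p)" if "x \<in> U \<inter> (\<Inter>p\<in>P. snd p)" "R `` {x} = {x}" for x
    using that(1) C(4)[OF _ _ that(2)] by auto
qed simp

lemma Union_mem_carrier_RS:
  assumes R: "preorder_on U R" and P: "P \<subseteq> carrier (RS U R)"
  shows "((\<Union>p\<in>P. fst p), (\<Union>p\<in>P. snd p)) \<in> carrier (RS U R)"
  unfolding mem_carrier_RS_iff[OF R]
proof (intro conjI allI impI ballI)
  note C = carrier_RS_closed[OF R subsetD[OF P]]
  show "(\<Union>p\<in>P. fst p) \<subseteq> (\<Union>p\<in>P. snd p)" "(\<Union>p\<in>P. snd p) \<subseteq> U"
    using C(1) carrier_RS_subset(2)[OF subsetD[OF P]] by blast+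
  show "y \<in> (\<Union>p\<in>P. fst p)" if "(x, y) \<in> R" "x \<in> (\<Union>p\<in>P. fst p)" for x y
    using that(2) C(2)[OF _ that(1)] by blast
  show "x \<in> (\<Union>p\<in>P. snd p)" if "(x, y) \<in> R" "y \<in> (\<Union>p\<in>P. snd p)" for x y
    using that(2) C(3)[OF _ that(1)] by blast
  show "x \<in> (\<Union>p\<in>P. fst p)" if "x \<in> (\<Union>p\<in>P. snd p)" "R `` {x} = {x}" for x
    using that(1) C(4)[OF _ _ that(2)] by blast
qed

lemma greatest_Lower_RS:
  assumes "preorder_on U R" "P \<subseteq> carrier (RS U R)"
  shows "greatest (RS U R) (U \<inter> (\<Inter>p\<in>P. fst p), U \<inter> (\<Inter>p\<in>P. snd p)) (Lower (RS U R) P)"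
  unfolding greatest_def
proof (intro conjI ballI)
  show "(U \<inter> (\<Inter>p\<in>P. fst p), U \<inter> (\<Inter>p\<in>P. snd p)) \<in> Lower (RS U R) P"
    using Inter_mem_carrier_RS[OF assms] by (auto simp: Lower_def)
  fix q assume "q \<in> Lower (RS U R) P"
  then have "q \<in> carrier (RS U R)" "\<And>p. p \<in> P \<Longrightarrow> fst q \<subseteq> fst p \<and> snd q \<subseteq> snd p"
    using Lower_memD[of q "RS U R" P] assms(2) by (auto intro: subsetD[OF Lower_closed])
  then show "q \<sqsubseteq>\<^bsub>RS U R\<^esub> (U \<inter> (\<Inter>p\<in>P. fst p), U \<inter> (\<Inter>p\<in>P. snd p))"
    using carrier_RS_subset[of q U R] by (simp add: le_INF_iff)
qed simp

lemma least_Upper_RS: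
  assumes "preorder_on U R" "P \<subseteq> carrier (RS U R)"
  shows "least (RS U R) ((\<Union>p\<in>P. fst p), (\<Union>p\<in>P. snd p)) (Upper (RS U R) P)"
  unfolding least_def
proof (intro conjI ballI)
  show "((\<Union>p\<in>P. fst p), (\<Union>p\<in>P. snd p)) \<in> Upper (RS U R) P"
    using Union_mem_carrier_RS[OF assms] by (auto simp: Upper_def)
  fix q assume "q \<in> Upper (RS U R) P"
  then have "\<And>p. p \<in> P \<Longrightarrow> fst p \<subseteq> fst q \<and> snd p \<subseteq> snd q"
    using Upper_memD[of q "RS U R" P] assms(2) by auto
  then show "((\<Union>p\<in>P. fst p), (\<Union>p\<in>P. snd p)) \<sqsubseteq>\<^bsub>RS U R\<^esub> q"
    by (simp add: UN_subset_iff)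
qed simp

lemma complete_lattice_RS:
  assumes "preorder_on U R"
  shows "complete_lattice (RS U R)"
  using partial_order.complete_latticeI[OF partial_order_RS]
    greatest_Lower_RS[OF assms] least_Upper_RS[OF assms] by blast

lemma Inf_RS:
  assumes "preorder_on U R" "P \<subseteq> carrier (RS U R)"
  shows "\<Sqinter>\<^bsub>RS U R\<^esub> P = (U \<inter> (\<Inter>p\<in>P. fst p), U \<inter> (\<Inter>p\<in>P. snd p))"
  unfolding Lattice.inf_def
  using greatest_Lower_RS[OF assms] partial_order.greatest_unique[OF partial_order_RS]
  by (intro some_equality) blast+

lemma Sup_RS:
  assumes "preorder_on U R" "P \<subseteq> carrier (RS U R)"
  shows "\<Squnion>\<^bsub>RS U R\<^esub> P = ((\<Union>p\<in>P. fst p), (\<Union>p\<in>P. snd p))"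
  unfolding Lattice.sup_def
  using least_Upper_RS[OF assms] partial_order.least_unique[OF partial_order_RS]
  by (intro some_equality) blast+

section \<open>Complete distributivity\<close>

text \<open>
  Choosing for each \<open>Y\<close> an element \<open>p\<close> whose set \<open>h p\<close> contains \<open>x\<close> gives the choice function
  that puts \<open>x\<close> into the right-hand side. The map \<open>h\<close> lets this form of the complete
  distributivity of \<open>\<wp>(U)\<close> apply to rough sets through either projection, and the intersection
  with \<open>U\<close> gives the empty meet its value.
\<close>

lemma Inter_Union_choice:
  "U \<inter> (\<Inter>Y\<in>A. \<Union>p\<in>Y. h p) =
    (\<Union>Z\<in>{f ` A | f. \<forall>Y\<in>A. f Y \<in> Y}. U \<inter> (\<Inter>p\<in>Z. h p))"
proof (intro equalityI subsetI)
  fix x assume x: "x \<in> U \<inter> (\<Inter>Y\<in>A. \<Union>p\<in>Y. h p)"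
  then have "\<forall>Y\<in>A. \<exists>p. p \<in> Y \<and> x \<in> h p" by blast
  then obtain f where "\<forall>Y\<in>A. f Y \<in> Y \<and> x \<in> h (f Y)" by metis
  with x show "x \<in> (\<Union>Z\<in>{f ` A | f. \<forall>Y\<in>A. f Y \<in> Y}. U \<inter> (\<Inter>p\<in>Z. h p))"
    by (intro UN_I[of "f ` A"]) auto
qed blast

lemma completely_distributive_lattice_RS:
  assumes R: "preorder_on U R"
  shows "completely_distributive_lattice (RS U R)"
proof -
  interpret complete_lattice "RS U R"
    by (rule complete_lattice_RS[OF R])
  show ?thesis
  proof
    fix A assume A: "\<And>Y. Y \<in> A \<Longrightarrow> Y \<subseteq> carrier (RS U R)"
    let ?F = "{f ` A | f. \<forall>Y\<in>A. f Y \<in> Y}"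
    have F: "Z \<subseteq> carrier (RS U R)" if "Z \<in> ?F" for Z
      using that A by blast
    have "\<Sqinter>\<^bsub>RS U R\<^esub> ((\<lambda>Y. \<Squnion>\<^bsub>RS U R\<^esub> Y) ` A) =
        (U \<inter> (\<Inter>Y\<in>A. \<Union>p\<in>Y. fst p), U \<inter> (\<Inter>Y\<in>A. \<Union>p\<in>Y. snd p))"
      using A weak.sup_closed by (subst Inf_RS[OF R]) (auto simp: Sup_RS[OF R])
    also have "\<dots> = ((\<Union>Z\<in>?F. U \<inter> (\<Inter>p\<in>Z. fst p)), (\<Union>Z\<in>?F. U \<inter> (\<Inter>p\<in>Z. snd p)))"
      by (simp only: Inter_Union_choice)
    also have "\<dots> = \<Squnion>\<^bsub>RS U R\<^esub> ((\<lambda>Z. \<Sqinter>\<^bsub>RS U R\<^esub> Z) ` ?F)"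
    proof -
      have closed: "(\<lambda>Z. \<Sqinter>\<^bsub>RS U R\<^esub> Z) ` ?F \<subseteq> carrier (RS U R)"
        using F by (blast intro: weak.inf_closed)
      have "(\<lambda>Z. \<Sqinter>\<^bsub>RS U R\<^esub> Z) ` ?F =
          (\<lambda>Z. (U \<inter> (\<Inter>p\<in>Z. fst p), U \<inter> (\<Inter>p\<in>Z. snd p))) ` ?F"
        by (rule image_cong) (simp_all only: Inf_RS[OF R F])
      then show ?thesis
        unfolding Sup_RS[OF R closed] by (simp only: image_image fst_conv snd_conv)
    qed
    finally show "\<Sqinter>\<^bsub>RS U R\<^esub> ((\<lambda>Y. \<Squnion>\<^bsub>RS U R\<^esub> Y) ` A) = \<Squnion>\<^bsub>RS U R\<^esub> ((\<lambda>Z. \<Sqinter>\<^bsub>RS U R\<^esub> Z) ` ?F)" .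
  qed
qed

theorem corollary3p3:
  fixes U :: "'a set" and R :: "'a rel"
  assumes "U \<noteq> {}"
    and "preorder_on U R"
  shows "completely_distributive_lattice (RS U R) \<and>
    (\<forall>(I :: 'i set) (X :: 'i \<Rightarrow> 'a set). (\<forall>i\<in>I. X i \<subseteq> U) \<longrightarrow>
      \<Sqinter>\<^bsub>RS U R\<^esub> ((\<lambda>i. rough_set U R (X i)) ` I) =
        (U \<inter> (\<Inter>i\<in>I. lower_approx U R (X i)), U \<inter> (\<Inter>i\<in>I. upper_approx U R (X i))) \<and>
      \<Squnion>\<^bsub>RS U R\<^esub> ((\<lambda>i. rough_set U R (X i)) ` I) =
        ((\<Union>i\<in>I. lower_approx U R (X i)), (\<Union>i\<in>I. upper_approx U R (X i))))"
proof (intro conjI allI impI)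
  show "completely_distributive_lattice (RS U R)"
    by (rule completely_distributive_lattice_RS[OF assms(2)])
next
  fix I :: "'i set" and X :: "'i \<Rightarrow> 'a set"
  assume "\<forall>i\<in>I. X i \<subseteq> U"
  then have P: "(\<lambda>i. rough_set U R (X i)) ` I \<subseteq> carrier (RS U R)"
    by (auto simp: RS_def)
  show "\<Sqinter>\<^bsub>RS U R\<^esub> ((\<lambda>i. rough_set U R (X i)) ` I) =
      (U \<inter> (\<Inter>i\<in>I. lower_approx U R (X i)), U \<inter> (\<Inter>i\<in>I. upper_approx U R (X i)))"
    by (subst Inf_RS[OF assms(2) P]) (simp add: rough_set_def)
  show "\<Squnion>\<^bsub>RS U R\<^esub> ((\<lambda>i. rough_set U R (X i)) ` I) =
      ((\<Union>i\<in>I. lower_approx U R (X i)), (\<Union>i\<in>I. upper_approx U R (X i)))"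
    by (subst Sup_RS[OF assms(2) P]) (simp add: rough_set_def)
qed

end
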